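(* Let $L\ge 0$, $\alpha>0$, $\mu_0>0$, $\lambda\in(0,1)$, $t_0\in\mathbb{R}$, let $\mu_k=\mu_0\lambda^k$ for $k\ge 0$, and let $(t_k)_{k\ge 0}$ be defined by $t_{k+1}-t_k=\dfrac{1}{L+\alpha/\mu_k}$. Write $\mu(t_k)=\mu_k$. Then for every $k\ge 1$, $$(L+\alpha\mu_0^{-1})^{-1}\frac{1-\lambda^k}{1-\lambda}\le t_k-t_0\le(\alpha\mu_0^{-1})^{-1}\frac{1-\lambda^k}{1-\lambda}<+\infty,$$ $$\mu_0-(\mu_0L+\alpha)(1-\lambda)(t_k-t_0)\le\mu(t_k)\le\mu_0-\alpha(1-\lambda)(t_k-t_0).$$
   Context: Here $t_k$ are the discretized time points of the forward Euler scheme with step $s_k=t_{k+1}-t_k=1/(L+\alpha/\mu(t_k))$, where $L$ is a smoothness constant and $\alpha$ a smoothing constant; only the recursion in the claim is needed. *)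

theory Defs
  imports Complex_Main "HOL-Library.Extended_Real"
begin

end

theory Submission imports Defs begin

text \<open>
  The step \<open>1 / (L + \<alpha> / \<mu>\<^sub>j)\<close> lies between two constant multiples of \<open>lam ^ j\<close>: writing \<open>\<alpha> / \<mu>\<^sub>j\<close>
  as \<open>(\<alpha> / \<mu>\<^sub>0) / lam ^ j\<close>, discarding \<open>L\<close> does not decrease the step and gives \<open>lam ^ j / (\<alpha> / \<mu>\<^sub>0)\<close>;
  replacing \<open>L\<close> by \<open>L / lam ^ j \<ge> L\<close> does not increase it and gives \<open>lam ^ j / (L + \<alpha> / \<mu>\<^sub>0)\<close>
  (lemma \<open>smoothed_step_bounds\<close>). Telescoping and summing the geometric series turns this into
  the bounds on \<open>t k - t 0\<close> (lemma \<open>geometric_increments_bounds\<close>).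

  The bounds on \<open>\<mu> (t k)\<close> are the same two inequalities solved for \<open>\<mu>\<^sub>k\<close>, because
  \<open>\<mu>\<^sub>0 - \<mu>\<^sub>k = \<mu>\<^sub>0 * (1 - lam ^ k)\<close> is a multiple of the geometric sum.
\<close>

text \<open>
  The parameter \<open>a\<close> stands for \<open>\<alpha> / \<mu>\<^sub>0\<close> and \<open>x\<close> for a power of \<open>lam\<close>; \<open>x \<le> 1\<close> gives
  \<open>L \<le> L / x\<close>, from which the lower bound follows.
\<close>
lemma smoothed_step_bounds:
  fixes L a x :: real
  assumes "L \<ge> 0" and "a > 0" and "0 < x" and "x \<le> 1"
  shows "inverse (L + a) * x \<le> 1 / (L + a / x)"
    and "1 / (L + a / x) \<le> inverse a * x"
proof -
  have step: "1 / (L + a / x) = x / (L * x + a)"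
    using assms by (simp add: field_simps)
  have "0 \<le> L * x" and "L * x \<le> L"
    using assms by (simp_all add: mult_left_le)
  with assms have "x / (L + a) \<le> x / (L * x + a)" and "x / (L * x + a) \<le> x / a"
    by (auto intro!: divide_left_mono mult_pos_pos)
  then show "inverse (L + a) * x \<le> 1 / (L + a / x)" and "1 / (L + a / x) \<le> inverse a * x"
    unfolding step by (simp_all add: divide_inverse mult.commute)
qed

lemma geometric_increments_bounds:
  fixes t :: "nat \<Rightarrow> real" and c d q :: real
  assumes "q \<noteq> 1"
    and lower: "\<And>j. c * q ^ j \<le> t (Suc j) - t j"
    and upper: "\<And>j. t (Suc j) - t j \<le> d * q ^ j"
  shows "c * ((1 - q ^ k) / (1 - q)) \<le> t k - t 0"
    and "t k - t 0 \<le> d * ((1 - q ^ k) / (1 - q))"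
proof -
  have geometric: "(1 - q ^ k) / (1 - q) = (\<Sum>j<k. q ^ j)"
    using assms(1) by (simp add: sum_gp_strict)
  have telescope: "t k - t 0 = (\<Sum>j<k. t (Suc j) - t j)"
    by (simp add: sum_lessThan_telescope)
  show "c * ((1 - q ^ k) / (1 - q)) \<le> t k - t 0"
    and "t k - t 0 \<le> d * ((1 - q ^ k) / (1 - q))"
    unfolding geometric telescope sum_distrib_left
    by (auto intro: sum_mono lower upper)
qed

theorem theorem4:
  fixes L \<alpha> \<mu>\<^sub>0 lam t\<^sub>0 :: real
    and \<mu>s t :: "nat \<Rightarrow> real"
    and \<mu> :: "real \<Rightarrow> real"
    and k :: nat
  assumes "L \<ge> 0" and "\<alpha> > 0" and "\<mu>\<^sub>0 > 0" and "0 < lam" and "lam < 1"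
    and "\<And>j. \<mu>s j = \<mu>\<^sub>0 * lam ^ j"
    and "t 0 = t\<^sub>0"
    and "\<And>j. t (Suc j) - t j = 1 / (L + \<alpha> / \<mu>s j)"
    and "\<And>j. \<mu> (t j) = \<mu>s j"
    and "k \<ge> 1"
  shows "inverse (L + \<alpha> * inverse \<mu>\<^sub>0) * ((1 - lam ^ k) / (1 - lam)) \<le> t k - t\<^sub>0
       \<and> t k - t\<^sub>0 \<le> inverse (\<alpha> * inverse \<mu>\<^sub>0) * ((1 - lam ^ k) / (1 - lam))
       \<and> ereal (inverse (\<alpha> * inverse \<mu>\<^sub>0) * ((1 - lam ^ k) / (1 - lam))) < \<infinity>
       \<and> \<mu>\<^sub>0 - (\<mu>\<^sub>0 * L + \<alpha>) * (1 - lam) * (t k - t\<^sub>0) \<le> \<mu> (t k)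
       \<and> \<mu> (t k) \<le> \<mu>\<^sub>0 - \<alpha> * (1 - lam) * (t k - t\<^sub>0)"
proof -
  define a where "a = \<alpha> * inverse \<mu>\<^sub>0"
  define S where "S = (1 - lam ^ k) / (1 - lam)"
  have "a > 0"
    using assms(2,3) by (simp add: a_def)
  have step: "t (Suc j) - t j = 1 / (L + a / lam ^ j)" for j
    using assms(6,8)[of j] by (simp add: a_def divide_inverse)
  have power: "0 < lam ^ j" "lam ^ j \<le> 1" for j
    using assms(4,5) by (simp_all add: power_le_one)
  have "lam \<noteq> 1"
    using assms(5) by simp
  have step_lower: "inverse (L + a) * lam ^ j \<le> t (Suc j) - t j"
    and step_upper: "t (Suc j) - t j \<le> inverse a * lam ^ j" for j
    unfolding step using smoothed_step_bounds[OF assms(1) \<open>a > 0\<close> power] by auto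
  have lower: "inverse (L + a) * S \<le> t k - t\<^sub>0" and upper: "t k - t\<^sub>0 \<le> inverse a * S"
    unfolding S_def assms(7)[symmetric]
    by (rule geometric_increments_bounds[OF \<open>lam \<noteq> 1\<close> step_lower step_upper])+
  have \<mu>_k: "\<mu> (t k) = \<mu>\<^sub>0 - \<mu>\<^sub>0 * (1 - lam) * S"
    using assms(5,6,9) by (simp add: S_def field_simps)
  have \<alpha>_eq: "\<alpha> = \<mu>\<^sub>0 * a"
    using assms(3) by (simp add: a_def field_simps)
  have "S \<le> (L + a) * (t k - t\<^sub>0)" and "a * (t k - t\<^sub>0) \<le> S"
    using lower upper assms(1) \<open>a > 0\<close> by (simp_all add: field_simps)
  then have "\<mu>\<^sub>0 * (1 - lam) * S \<le> \<mu>\<^sub>0 * (1 - lam) * ((L + a) * (t k - t\<^sub>0))"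
    and "\<mu>\<^sub>0 * (1 - lam) * (a * (t k - t\<^sub>0)) \<le> \<mu>\<^sub>0 * (1 - lam) * S"
    using assms(3,5) by (auto intro!: mult_left_mono)
  then have "\<mu>\<^sub>0 - (\<mu>\<^sub>0 * L + \<alpha>) * (1 - lam) * (t k - t\<^sub>0) \<le> \<mu> (t k)"
    and "\<mu> (t k) \<le> \<mu>\<^sub>0 - \<alpha> * (1 - lam) * (t k - t\<^sub>0)"
    unfolding \<mu>_k \<alpha>_eq by (simp_all add: algebra_simps)
  with lower upper show ?thesis
    by (simp add: a_def S_def)
qed

end
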